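(* Let $S$ be a $\Gamma$-semigroup, let $I$ be an ideal of $S$, and let $M=(\mu_I,\mu_I^c)$, where $\mu_I$ is the characteristic function of $I$ and $\mu_I^c=1-\mu_I$. Then $I$ is a prime ideal of $S$ if and only if $\langle x,M\rangle=M$ for every $x\in S$ with $x\notin I$.
   Context: $\Gamma$-semigroup (both sided): non-empty sets $S,\Gamma$ with maps $S\times\Gamma\times S\to S$, $(a,\alpha,b)\mapsto a\alpha b$, and $\Gamma\times S\times\Gamma\to\Gamma$, $(\alpha,a,\beta)\mapsto\alpha a\beta$, such that $(a\alpha b)\beta c=a(\alpha b\beta)c=a\alpha(b\beta c)$ and $\alpha(a\beta b)\gamma=(\alpha a\beta)b\gamma=\alpha a(\beta b\gamma)$ for all $a,b,c\in S$, $\alpha,\beta,\gamma\in\Gamma$. For $A,B\subseteq S$, $A\Gamma B=\{a\gamma b:a\in A,\gamma\in\Gamma,b\in B\}$. An ideal of $S$ is a non-empty $I\subseteq S$ with $S\Gamma I\subseteq I$ and $I\Gamma S\subseteq I$. An ideal $P$ is prime if for any ideals $A,B$ of $S$, $A\Gamma B\subseteq P$ implies $A\subseteq P$ or $B\subseteq P$. An intuitionistic fuzzy set (IFS) of $S$ is a pair $A=(\mu_A,\nu_A)$ of functions $S\to[0,1]$ with $\mu_A(x)+\nu_A(x)\le1$ for all $x$; two IFS are equal if both component functions agree. For $x\in S$, the extension of $A$ by $x$ is the IFS $\langle x,A\rangle=(\langle x,\mu_A\rangle,\langle x,\nu_A\rangle)$ with $\langle x,\mu_A\rangle(y)=\inf_{\gamma\in\Gamma}\mu_A(x\gamma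 y)$ and $\langle x,\nu_A\rangle(y)=\sup_{\gamma\in\Gamma}\nu_A(x\gamma y)$ for $y\in S$. *)

theory Defs
  imports Complex_Main "HOL-Library.Indicator_Function"
begin

text \<open>
  The non-empty sets \<open>S\<close> and \<open>\<Gamma>\<close> are the universes of the types \<open>'s\<close> and \<open>'g\<close>:
  \<open>mul a \<alpha> b\<close> is \<open>a \<alpha> b \<in> S\<close> and \<open>gmul \<alpha> a \<beta>\<close> is \<open>\<alpha> a \<beta> \<in> \<Gamma>\<close>.
\<close>

locale gamma_semigroup =
  fixes mul :: "'s \<Rightarrow> 'g \<Rightarrow> 's \<Rightarrow> 's"
    and gmul :: "'g \<Rightarrow> 's \<Rightarrow> 'g \<Rightarrow> 'g"
  assumes mul_assoc_left: "mul (mul a \<alpha> b) \<beta> c = mul a (gmul \<alpha> b \<beta>) c"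
    and mul_assoc_right: "mul a (gmul \<alpha> b \<beta>) c = mul a \<alpha> (mul b \<beta> c)"
    and gmul_assoc_left: "gmul \<alpha> (mul a \<beta> b) \<gamma> = gmul (gmul \<alpha> a \<beta>) b \<gamma>"
    and gmul_assoc_right: "gmul (gmul \<alpha> a \<beta>) b \<gamma> = gmul \<alpha> a (gmul \<beta> b \<gamma>)"

definition gamma_prod :: "('s \<Rightarrow> 'g \<Rightarrow> 's \<Rightarrow> 's) \<Rightarrow> 's set \<Rightarrow> 's set \<Rightarrow> 's set" where
  "gamma_prod mul A B = {mul a \<gamma> b | a \<gamma> b. a \<in> A \<and> b \<in> B}"

definition gamma_ideal :: "('s \<Rightarrow> 'g \<Rightarrow> 's \<Rightarrow> 's) \<Rightarrow> 's set \<Rightarrow> bool" where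
  "gamma_ideal mul I \<longleftrightarrow>
     I \<noteq> {} \<and> gamma_prod mul UNIV I \<subseteq> I \<and> gamma_prod mul I UNIV \<subseteq> I"

definition gamma_prime_ideal :: "('s \<Rightarrow> 'g \<Rightarrow> 's \<Rightarrow> 's) \<Rightarrow> 's set \<Rightarrow> bool" where
  "gamma_prime_ideal mul P \<longleftrightarrow>
     gamma_ideal mul P \<and>
     (\<forall>A B. gamma_ideal mul A \<longrightarrow> gamma_ideal mul B \<longrightarrow>
        gamma_prod mul A B \<subseteq> P \<longrightarrow> A \<subseteq> P \<or> B \<subseteq> P)"

definition is_ifs :: "('s \<Rightarrow> real) \<times> ('s \<Rightarrow> real) \<Rightarrow> bool" where
  "is_ifs A \<longleftrightarrow>
     (\<forall>x. fst A x \<in> {0..1} \<and> snd A x \<in> {0..1} \<and> fst A x + snd A x \<le> 1)"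

text \<open>
  The infimum and supremum are those of the conditionally complete lattice of reals; they are
  genuine because the component functions of an intuitionistic fuzzy set are bounded.
\<close>

definition ifs_extension ::
  "('s \<Rightarrow> 'g \<Rightarrow> 's \<Rightarrow> 's) \<Rightarrow> 's \<Rightarrow> ('s \<Rightarrow> real) \<times> ('s \<Rightarrow> real) \<Rightarrow> ('s \<Rightarrow> real) \<times> ('s \<Rightarrow> real)"
  where
  "ifs_extension mul x A =
     ((\<lambda>y. INF \<gamma>. fst A (mul x \<gamma> y)), (\<lambda>y. SUP \<gamma>. snd A (mul x \<gamma> y)))"

definition characteristic_ifs :: "'s set \<Rightarrow> ('s \<Rightarrow> real) \<times> ('s \<Rightarrow> real)" where
  "characteristic_ifs I = (indicator I, \<lambda>y. 1 - indicator I y)"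

lemma is_ifs_characteristic_ifs: "is_ifs (characteristic_ifs I)"
  by (auto simp: is_ifs_def characteristic_ifs_def indicator_def)

lemma is_ifs_ifs_extension:
  assumes "is_ifs A"
  shows "is_ifs (ifs_extension mul x A)"
  unfolding is_ifs_def
proof
  fix y
  define f where "f = (\<lambda>\<gamma>. fst A (mul x \<gamma> y))"
  define g where "g = (\<lambda>\<gamma>. snd A (mul x \<gamma> y))"
  have f: "0 \<le> f \<gamma>" "f \<gamma> \<le> 1" and g: "0 \<le> g \<gamma>" "g \<gamma> \<le> 1" and fg: "f \<gamma> + g \<gamma> \<le> 1" for \<gamma>
    using assms by (auto simp: is_ifs_def f_def g_def)
  have bf: "bdd_below (range f)" and bg: "bdd_above (range g)"
    using f g by (auto intro!: bdd_belowI bdd_aboveI)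
  have inf_le: "(INF \<gamma>. f \<gamma>) \<le> f \<gamma>" and le_sup: "g \<gamma> \<le> (SUP \<gamma>. g \<gamma>)" for \<gamma>
    using bf bg by (auto intro: cINF_lower cSUP_upper)
  have "0 \<le> (INF \<gamma>. f \<gamma>)" by (rule cINF_greatest) (use f in auto)
  moreover have "(INF \<gamma>. f \<gamma>) \<le> 1" using inf_le f order_trans by blast
  moreover have "0 \<le> (SUP \<gamma>. g \<gamma>)" using le_sup g order_trans by blast
  moreover have "(SUP \<gamma>. g \<gamma>) \<le> 1" by (rule cSUP_least) (use g in auto)
  moreover have "(SUP \<gamma>. g \<gamma>) \<le> 1 - (INF \<gamma>. f \<gamma>)"
  proof (rule cSUP_least)
    show "g \<gamma> \<le> 1 - (INF \<gamma>. f \<gamma>)" for \<gamma> using inf_le[of \<gamma>] fg[of \<gamma>] by linarith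
  qed simp
  ultimately show "fst (ifs_extension mul x A) y \<in> {0..1} \<and> snd (ifs_extension mul x A) y \<in> {0..1} \<and>
      fst (ifs_extension mul x A) y + snd (ifs_extension mul x A) y \<le> 1"
    by (simp add: ifs_extension_def f_def g_def)
qed

end

theory Submission
  imports Defs
begin

text \<open>
  Evaluating the infimum and supremum, the extension of the characteristic fuzzy set of \<open>I\<close> by \<open>x\<close>
  is the characteristic fuzzy set of \<open>{y. x \<Gamma> y \<subseteq> I}\<close>. So the condition says that
  \<open>x \<Gamma> y \<subseteq> I\<close> forces \<open>x \<in> I\<close> or \<open>y \<in> I\<close>. To obtain this from primeness, no generated
  ideals are needed: \<open>B = {b. x \<Gamma> b \<subseteq> I}\<close> is an ideal, since \<open>x \<gamma> (s \<delta> b) = x (\<gamma> s \<delta>) b\<close>, and so is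
  \<open>A = {a. a \<Gamma> B \<subseteq> I}\<close>, which contains \<open>x\<close>.
\<close>

text \<open>The values lie in {0, 1}: a single \<open>f \<gamma>\<close> outside \<open>I\<close>
  attains the minimum 0; otherwise the family is constantly 1 over a non-empty index type.\<close>

lemma INF_indicator:
  "(INF \<gamma>. indicator I (f \<gamma>) :: real) = of_bool (\<forall>\<gamma>. f \<gamma> \<in> I)"
proof (cases "\<forall>\<gamma>. f \<gamma> \<in> I")
  case False
  then obtain \<gamma> where \<gamma>: "f \<gamma> \<notin> I" by blast
  have "(INF \<gamma>. indicator I (f \<gamma>) :: real) = 0"
  proof (rule cInf_eq_minimum)
    show "0 \<in> range (\<lambda>\<gamma>. indicator I (f \<gamma>) :: real)"
      using \<gamma> by (intro image_eqI[of _ _ \<gamma>]) auto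
  qed (auto simp: indicator_def)
  with False show ?thesis by simp
qed simp

lemma SUP_one_minus_indicator:
  "(SUP \<gamma>. 1 - indicator I (f \<gamma>) :: real) = 1 - of_bool (\<forall>\<gamma>. f \<gamma> \<in> I)"
proof (cases "\<forall>\<gamma>. f \<gamma> \<in> I")
  case False
  then obtain \<gamma> where \<gamma>: "f \<gamma> \<notin> I" by blast
  have "(SUP \<gamma>. 1 - indicator I (f \<gamma>) :: real) = 1"
  proof (rule cSup_eq_maximum)
    show "1 \<in> range (\<lambda>\<gamma>. 1 - indicator I (f \<gamma>) :: real)"
      using \<gamma> by (intro image_eqI[of _ _ \<gamma>]) auto
  qed (auto simp: indicator_def)
  with False show ?thesis by simp
qed simp

lemma ifs_extension_characteristic_ifs:
  "ifs_extension mul x (characteristic_ifs I) = characteristic_ifs {y. \<forall>\<gamma>. mul x \<gamma> y \<in> I}"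
  unfolding ifs_extension_def characteristic_ifs_def fst_conv snd_conv
    INF_indicator SUP_one_minus_indicator
  by (simp add: fun_eq_iff indicator_def)

lemma characteristic_ifs_eq_iff: "characteristic_ifs A = characteristic_ifs B \<longleftrightarrow> A = B"
  by (auto simp: characteristic_ifs_def indicator_def fun_eq_iff split: if_splits)

lemma gamma_ideal_iff:
  "gamma_ideal mul I \<longleftrightarrow>
    I \<noteq> {} \<and> (\<forall>s \<gamma> a. a \<in> I \<longrightarrow> mul s \<gamma> a \<in> I) \<and> (\<forall>a \<gamma> s. a \<in> I \<longrightarrow> mul a \<gamma> s \<in> I)"
  unfolding gamma_ideal_def gamma_prod_def by blast

context gamma_semigroup
begin

lemma mul_assoc: "mul (mul a \<alpha> b) \<beta> c = mul a \<alpha> (mul b \<beta> c)"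
  using mul_assoc_left mul_assoc_right by simp

text \<open>Left factors are absorbed into \<open>\<Gamma>\<close> by \<open>gmul\<close>; right
  factors are absorbed by \<open>I\<close>. The set is non-empty because it contains
  \<open>I\<close>.\<close>

lemma gamma_ideal_right_quotient:
  assumes "gamma_ideal mul I"
  shows "gamma_ideal mul {b. \<forall>\<gamma>. mul x \<gamma> b \<in> I}"
proof -
  have "mul x \<gamma> (mul s \<delta> b) \<in> I" if "\<forall>\<gamma>. mul x \<gamma> b \<in> I" for \<gamma> s \<delta> b
    using that mul_assoc_right by metis
  moreover have "mul x \<gamma> (mul b \<delta> s) \<in> I" if "\<forall>\<gamma>. mul x \<gamma> b \<in> I" for \<gamma> s \<delta> b
    using that assms mul_assoc unfolding gamma_ideal_iff by metis
  ultimately show ?thesis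
    using assms unfolding gamma_ideal_iff by blast
qed

text \<open>For \<open>a\<close> in the set and \<open>b\<close> in \<open>B\<close>, (s \<delta> a)
  \<gamma> b = s \<delta> (a \<gamma> b) stays in \<open>I\<close>, while (a \<delta> s) \<gamma> b
  = a \<delta> (s \<gamma> b) with s \<gamma> b again in \<open>B\<close>.\<close>

lemma gamma_ideal_left_quotient:
  assumes I: "gamma_ideal mul I" and B: "gamma_ideal mul B"
  shows "gamma_ideal mul {a. \<forall>b\<in>B. \<forall>\<gamma>. mul a \<gamma> b \<in> I}"
proof -
  have "{a. \<forall>b\<in>B. \<forall>\<gamma>. mul a \<gamma> b \<in> I} \<noteq> {}"
    using I unfolding gamma_ideal_iff by blast
  then show ?thesis
    using assms unfolding gamma_ideal_iff by (simp add: mul_assoc)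
qed

lemma gamma_prime_ideal_iff_elementwise:
  assumes I: "gamma_ideal mul I"
  shows "gamma_prime_ideal mul I \<longleftrightarrow> (\<forall>x y. (\<forall>\<gamma>. mul x \<gamma> y \<in> I) \<longrightarrow> x \<in> I \<or> y \<in> I)"
proof (intro iffI allI impI)
  fix x y
  assume prime: "gamma_prime_ideal mul I" and xy: "\<forall>\<gamma>. mul x \<gamma> y \<in> I"
  define B where "B = {b. \<forall>\<gamma>. mul x \<gamma> b \<in> I}"
  define A where "A = {a. \<forall>b\<in>B. \<forall>\<gamma>. mul a \<gamma> b \<in> I}"
  have B: "gamma_ideal mul B"
    unfolding B_def using I by (rule gamma_ideal_right_quotient)
  have A: "gamma_ideal mul A"
    unfolding A_def using I B by (rule gamma_ideal_left_quotient)
  have "gamma_prod mul A B \<subseteq> I"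
    by (auto simp: gamma_prod_def A_def)
  then have "A \<subseteq> I \<or> B \<subseteq> I"
    using prime A B unfolding gamma_prime_ideal_def by blast
  moreover have "x \<in> A" "y \<in> B"
    using xy by (auto simp: A_def B_def)
  ultimately show "x \<in> I \<or> y \<in> I" by blast
next
  assume "\<forall>x y. (\<forall>\<gamma>. mul x \<gamma> y \<in> I) \<longrightarrow> x \<in> I \<or> y \<in> I"
  \<comment> \<open>Elements of \<open>A\<close> and \<open>B\<close> both outside \<open>I\<close>
    would have all their products in \<open>I\<close>, contradicting the assumption.\<close>
  then show "gamma_prime_ideal mul I"
    using I unfolding gamma_prime_ideal_def gamma_prod_def by blast
qed

end

theorem corollary5p14:
  fixes mul :: "'s \<Rightarrow> 'g \<Rightarrow> 's \<Rightarrow> 's"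
    and gmul :: "'g \<Rightarrow> 's \<Rightarrow> 'g \<Rightarrow> 'g"
    and I :: "'s set"
  assumes "gamma_semigroup mul gmul"
    and "gamma_ideal mul I"
  shows "gamma_prime_ideal mul I \<longleftrightarrow>
    (\<forall>x. x \<notin> I \<longrightarrow> ifs_extension mul x (characteristic_ifs I) = characteristic_ifs I)"
proof -
  \<comment> \<open>Since \<open>I\<close> absorbs left factors, it always lies in {y. x \<Gamma> y
    \<subseteq> I}; only the reverse inclusion is a condition.\<close>
  have "ifs_extension mul x (characteristic_ifs I) = characteristic_ifs I \<longleftrightarrow>
      (\<forall>y. (\<forall>\<gamma>. mul x \<gamma> y \<in> I) \<longrightarrow> y \<in> I)" for x
    using assms(2) unfolding ifs_extension_characteristic_ifs characteristic_ifs_eq_iff gamma_ideal_iff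
    by blast
  then show ?thesis
    using gamma_semigroup.gamma_prime_ideal_iff_elementwise[OF assms] by blast
qed

end
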